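(* Let $\phi:\mathbb{R}^n\to\mathbb{R}^n$ be a $C^1$ map, $K\subset\mathbb{R}^n$ a compact set with $\phi(K)\subseteq K$ and $K=\operatorname{cl}(\operatorname{int}K)$, and assume $A(x):=\mathrm{D}\phi(x)\in\mathrm{GL}(n,\mathbb{R})$ for all $x\in K$. Let $p$ be a symmetric positive definite $n\times n$ matrix and $k\in\{1,\ldots,n-1\}$. For $x\in K$ let $\zeta_x(p)=p^{1/2}A(x)p^{-1/2}$ and let $s_2(x)$ be the symmetric matrix produced by the procedure described in the context. Let $x,y\in K$ and assume that $$\delta:=\alpha_k(\zeta_y(p))-\alpha_{k+1}(\zeta_x(p))>0.$$ Then $$\|s_2(x)-s_2(y)\|_p\le\frac{\sqrt{2n(n+1)}}{\ln 2}\,\frac1\delta\,\|p^{1/2}\|_F\,\|p^{-1/2}\|_F\,\|A(x)-A(y)\|_F.$$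
   Context: $\alpha_1(M)\ge\cdots\ge\alpha_n(M)$ are the singular values of $M\in\mathbb{R}^{n\times n}$; $\|M\|_F=\sqrt{\operatorname{tr}(MM^\top)}$. $\mathcal{S}_n$ is the space of real symmetric $n\times n$ matrices. For $p$ symmetric positive definite, $\mathcal{S}_n$ carries the inner product $\langle v,w\rangle_p=\operatorname{tr}(p^{-1}vp^{-1}w)$ with norm $\|\cdot\|_p$. Procedure defining $s_2(x)$ (for fixed $p$ and $k$): let $\{e_i\}$ be an orthonormal basis of $(\mathcal{S}_n,\langle\cdot,\cdot\rangle_p)$ (the same basis for all $x$); let $X_i\in\mathcal{S}_n$ be the unique solution of the Lyapunov equation $p^{1/2}X_i+X_ip^{1/2}=e_i$; put $Z_i(x)=X_iA(x)p^{-1/2}-p^{1/2}A(x)p^{-1/2}X_ip^{-1/2}$ (the derivative of $p\mapsto\zeta_x(p)=p^{1/2}A(x)p^{-1/2}$ in direction $e_i$); take a singular value decomposition $\zeta_x(p)=U^\top\operatorname{diag}(\alpha_1(\zeta_x(p)),\ldots,\alpha_n(\zeta_x(p)))V$ with $U,V$ orthogonal; put $$S_x=\frac{1}{\ln 2}U^\top\operatorname{diag}\big(\alpha_1(\zeta_x(p))^{-1},\ldots,\alpha_k(\zeta_x(p))^{-1},0,\ldots,0\big)V;$$ finally $s_2(x)=\sum_i\operatorname{tr}[S_x^\top Z_i(x)]\,e_i$. (This is the computed candidate for a subgradient at $p$ of the function $p\mapsto\sum_{i=1}^k\log_2\alpha_i(\zeta_x(p))$; $U$ and $V$ may depend on $x$.)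 *)

theory Defs
  imports "HOL-Analysis.Analysis" "HOL-Computational_Algebra.Computational_Algebra"
begin

text \<open>
  Written with the type constructor \<open>vec\<close> because the notation \<open>real ^ 'n\<close> would force the sort
  of \<open>'n\<close> to be exactly \<open>finite\<close>.
\<close>

type_synonym 'n rvec = "(real, 'n) vec"
type_synonym 'n sqmat = "((real, 'n) vec, 'n) vec"

text \<open>
  Square matrices of size \<open>n\<close> are elements of \<open>'n sqmat\<close> with \<open>n = CARD('n)\<close>. The index
  type is linearly ordered; \<open>pos i\<close> is the position of \<open>i\<close> in the range \<open>1, \<dots>, n\<close>.
\<close>

definition pos :: "'n::{finite,linorder} \<Rightarrow> nat" where
  "pos i = card {j. j \<le> i}"

definition diag :: "(nat \<Rightarrow> real) \<Rightarrow> ('n::{finite,linorder}) sqmat" where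
  "diag d = (\<chi> i j. if i = j then d (pos i) else 0)"

definition charpoly :: "('n::finite) sqmat \<Rightarrow> real poly" where
  "charpoly M = det (mat [:0, 1:] - (\<chi> i j. [:M $ i $ j:]))"

text \<open>
  \<open>\<alpha> M i\<close> is the \<open>i\<close>-th largest singular value, counted from \<open>i = 1\<close> and with multiplicity;
  it is meaningful only for \<open>1 \<le> i \<le> n\<close>.
\<close>

definition \<alpha> :: "('n::finite) sqmat \<Rightarrow> nat \<Rightarrow> real" where
  "\<alpha> M i =
     rev (sorted_list_of_multiset (image_mset sqrt (proots (charpoly (transpose M ** M))))) ! (i - 1)"

definition fro_norm :: "('n::finite) sqmat \<Rightarrow> real" where
  "fro_norm M = sqrt (trace (M ** transpose M))"

definition sym_mats :: "(('n::finite) sqmat) set" where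
  "sym_mats = {M. transpose M = M}"

definition spd :: "('n::finite) sqmat \<Rightarrow> bool" where
  "spd p \<longleftrightarrow> p \<in> sym_mats \<and> (\<forall>v. v \<noteq> 0 \<longrightarrow> 0 < v \<bullet> (p *v v))"

definition msqrt :: "('n::finite) sqmat \<Rightarrow> 'n sqmat" where
  "msqrt p = (THE q. spd q \<and> q ** q = p)"

definition msqrt_inv :: "('n::finite) sqmat \<Rightarrow> 'n sqmat" where
  "msqrt_inv p = matrix_inv (msqrt p)"

definition inner_p :: "('n::finite) sqmat \<Rightarrow> 'n sqmat \<Rightarrow> 'n sqmat \<Rightarrow> real" where
  "inner_p p v w = trace (matrix_inv p ** v ** matrix_inv p ** w)"

definition norm_p :: "('n::finite) sqmat \<Rightarrow> 'n sqmat \<Rightarrow> real" where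
  "norm_p p v = sqrt (inner_p p v v)"

definition orthonormal_basis_p :: "('n::finite) sqmat \<Rightarrow> ('n sqmat) set \<Rightarrow> bool" where
  "orthonormal_basis_p p B \<longleftrightarrow>
     (\<forall>v\<in>B. \<forall>w\<in>B. inner_p p v w = (if v = w then 1 else 0)) \<and> span B = sym_mats"

definition zeta :: "('n::finite) sqmat \<Rightarrow> 'n sqmat \<Rightarrow> 'n sqmat" where
  "zeta p M = msqrt p ** M ** msqrt_inv p"

definition lyapunov :: "('n::finite) sqmat \<Rightarrow> 'n sqmat \<Rightarrow> 'n sqmat" where
  "lyapunov p e = (THE X. X \<in> sym_mats \<and> msqrt p ** X + X ** msqrt p = e)"

definition Z_dir :: "('n::finite) sqmat \<Rightarrow> 'n sqmat \<Rightarrow> 'n sqmat \<Rightarrow> 'n sqmat" where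
  "Z_dir p M e =
     lyapunov p e ** M ** msqrt_inv p
     - msqrt p ** M ** msqrt_inv p ** lyapunov p e ** msqrt_inv p"

text \<open>The convention is \<open>M = U\<^sup>T diag V\<close>, not \<open>U diag V\<^sup>T\<close>.\<close>

definition is_svd ::
  "('n::{finite,linorder}) sqmat \<Rightarrow> 'n sqmat \<Rightarrow> 'n sqmat \<Rightarrow> bool" where
  "is_svd M U V \<longleftrightarrow>
     orthogonal_matrix U \<and> orthogonal_matrix V \<and> M = transpose U ** diag (\<alpha> M) ** V"

definition S_mat ::
  "nat \<Rightarrow> ('n::{finite,linorder}) sqmat \<Rightarrow> 'n sqmat \<Rightarrow> 'n sqmat \<Rightarrow> 'n sqmat" where
  "S_mat k M U V =
     (1 / ln 2) *\<^sub>R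
       (transpose U ** diag (\<lambda>i. if i \<le> k then inverse (\<alpha> M i) else 0) ** V)"

text \<open>
  The candidate subgradient for the matrix \<open>M = A(x)\<close>, computed with the orthonormal basis \<open>B\<close>
  and the singular value decomposition of \<open>zeta p M\<close> given by \<open>U\<close> and \<open>V\<close>.
\<close>

definition s2 ::
  "('n::{finite,linorder}) sqmat \<Rightarrow> nat \<Rightarrow> ('n sqmat) set \<Rightarrow>
   'n sqmat \<Rightarrow> 'n sqmat \<Rightarrow> 'n sqmat \<Rightarrow> 'n sqmat" where
  "s2 p k B M U V =
     (\<Sum>e\<in>B. trace (transpose (S_mat k (zeta p M) U V) ** Z_dir p M e) *\<^sub>R e)"

definition C1_map :: "(('n::finite) rvec \<Rightarrow> 'n rvec) \<Rightarrow> bool" where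
  "C1_map f \<longleftrightarrow> f differentiable_on UNIV \<and> continuous_on UNIV (\<lambda>x. jacobian f (at x))"

end

theory Submission
  imports Defs
begin

text \<open>
  Write \<open>q = p\<^sup>1\<^sup>/\<^sup>2\<close>, \<open>r = q\<^sup>-\<^sup>1\<close>. If \<open>q X + X q = e\<close> then \<open>r e r\<close> is twice the symmetric part of \<open>X r\<close>, so the
  coefficient of \<open>e\<close> in \<open>s2\<close> at \<open>x\<close> is \<open>(P - Q) \<bullet> (r e r) / (2 ln 2)\<close>, where \<open>P\<close> and \<open>Q\<close> are the orthogonal
  projections onto the first \<open>k\<close> left and right singular directions. Since \<open>e \<mapsto> r e r\<close> is an isometry into
  the Frobenius norm, Bessel's inequality reduces the claim to the dependence of \<open>P\<close> and \<open>Q\<close> on the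
  matrix. For matrices \<open>M\<close>, \<open>N\<close> with singular values \<open>c\<^sub>i\<close>, \<open>d\<^sub>j\<close> and overlap matrices \<open>L\<close>, \<open>R\<close> of their
  left and right singular bases, the entries of \<open>M - N\<close> and of its transpose in the mixed bases are
  \<open>c\<^sub>i R\<^sub>i\<^sub>j - L\<^sub>i\<^sub>j d\<^sub>j\<close> and \<open>c\<^sub>i L\<^sub>i\<^sub>j - R\<^sub>i\<^sub>j d\<^sub>j\<close>; for \<open>j \<le> k < i\<close> the gap \<open>d\<^sub>j - c\<^sub>i \<ge> \<delta>\<close> bounds \<open>L\<^sub>i\<^sub>j\<close> and \<open>R\<^sub>i\<^sub>j\<close>
  by these entries, as in Wedin's theorem.
\<close>

no_notation fps_nth (infixl \<open>$\<close> 75)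

subsection \<open>Frobenius norm\<close>

lemma matrix_sub_ldistrib: "A ** (B - C) = A ** B - A ** (C :: 'a::ring_1 ^ 'n ^ 'm)"
  by (simp add: matrix_matrix_mult_def vec_eq_iff algebra_simps sum_subtractf)

lemma matrix_sub_rdistrib: "(A - B) ** C = A ** C - B ** (C :: 'a::ring_1 ^ 'n ^ 'm)"
  by (simp add: matrix_matrix_mult_def vec_eq_iff algebra_simps sum_subtractf)

lemma matrix_add_rdistrib: "(A + B) ** C = A ** C + B ** (C :: 'a::semiring_1 ^ 'n ^ 'm)"
  by (simp add: matrix_matrix_mult_def vec_eq_iff algebra_simps sum.distrib)

lemma transpose_add: "transpose (A + B) = transpose A + transpose B"
  by (simp add: transpose_def vec_eq_iff)

lemma transpose_diff: "transpose (A - B) = transpose A - transpose B"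
  by (simp add: transpose_def vec_eq_iff)

lemma trace_scaleR: "trace (c *\<^sub>R A) = c * trace (A :: real ^ 'n ^ 'n)"
  by (simp add: trace_def sum_distrib_left)

lemma inner_matrix_trace: "A \<bullet> B = trace (transpose A ** (B :: real ^ 'n ^ 'm))"
  unfolding trace_def matrix_matrix_mult_def transpose_def inner_vec_def inner_real_def
  by (simp, rule sum.swap)

lemma norm_matrix_sq: "(norm (A :: real ^ 'n ^ 'm))\<^sup>2 = (\<Sum>i\<in>UNIV. \<Sum>j\<in>UNIV. (A $ i $ j)\<^sup>2)"
  by (simp only: power2_norm_eq_inner inner_vec_def inner_real_def) (simp add: power2_eq_square)

lemma inner_transpose: "transpose A \<bullet> transpose B = A \<bullet> (B :: real ^ 'n ^ 'm)"
  unfolding transpose_def inner_vec_def inner_real_def by (simp, rule sum.swap)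

lemma norm_transpose: "norm (transpose A) = norm (A :: real ^ 'n ^ 'm)"
  by (simp add: norm_eq_sqrt_inner inner_transpose)

lemma fro_norm_eq_norm: "fro_norm M = norm M"
  by (metis fro_norm_def inner_matrix_trace norm_eq_sqrt_inner norm_transpose transpose_transpose)

text \<open>Each entry of the product is a row of \<open>A\<close> paired with a column of
  \<open>B\<close>; apply Cauchy-Schwarz to each and factor the double sum.\<close>

lemma norm_matrix_mult_le: "norm (A ** B) \<le> norm (A :: real ^ 'n ^ 'm) * norm (B :: real ^ 'k ^ 'n)"
proof (rule power2_le_imp_le)
  have "(norm (A ** B))\<^sup>2 = (\<Sum>i\<in>UNIV. \<Sum>j\<in>UNIV. (A $ i \<bullet> transpose B $ j)\<^sup>2)"
    unfolding norm_matrix_sq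
    by (simp add: matrix_matrix_mult_def inner_vec_def transpose_def)
  also have "\<dots> \<le> (\<Sum>i\<in>UNIV. \<Sum>j\<in>UNIV. (norm (A $ i))\<^sup>2 * (norm (transpose B $ j))\<^sup>2)"
    by (intro sum_mono) (metis Cauchy_Schwarz_ineq power2_norm_eq_inner)
  also have "\<dots> = (\<Sum>i\<in>UNIV. (norm (A $ i))\<^sup>2) * (\<Sum>j\<in>UNIV. (norm (transpose B $ j))\<^sup>2)"
    by (simp add: sum_product)
  also have "\<dots> = (norm A)\<^sup>2 * (norm (transpose B))\<^sup>2"
    by (simp add: power2_norm_eq_inner inner_vec_def)
  finally show "(norm (A ** B))\<^sup>2 \<le> (norm A * norm B)\<^sup>2"
    by (simp add: norm_transpose power_mult_distrib)
qed simp

text \<open>The adjoint of left multiplication by \<open>A\<close> is left multiplication by its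
  transpose; hence orthogonal factors preserve the norm.\<close>

lemma inner_matrix_left: "(A ** B) \<bullet> C = B \<bullet> (transpose A ** (C :: real ^ 'n ^ 'm))"
  by (simp add: inner_matrix_trace[of "A ** B"] inner_matrix_trace[of B] matrix_transpose_mul matrix_mul_assoc)

lemma norm_orthogonal_mult_left:
  assumes "orthogonal_matrix (Q :: real ^ 'n ^ 'n)"
  shows "norm (Q ** A) = norm (A :: real ^ 'n ^ 'n)"
  using assms
  by (simp add: norm_eq_sqrt_inner inner_matrix_left matrix_mul_assoc orthogonal_matrix_def)

lemma norm_orthogonal_mult_right:
  assumes "orthogonal_matrix (Q :: real ^ 'n ^ 'n)"
  shows "norm (A ** Q) = norm (A :: real ^ 'n ^ 'n)"
  by (metis assms matrix_transpose_mul norm_orthogonal_mult_left norm_transpose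
      orthogonal_matrix_transpose)

lemma norm_orthogonal_conjugate:
  assumes "orthogonal_matrix (P :: real ^ 'n ^ 'n)" "orthogonal_matrix (Q :: real ^ 'n ^ 'n)"
  shows "norm (P ** A ** transpose Q) = norm A"
proof -
  have "orthogonal_matrix (transpose Q)"
    using assms(2) by (simp add: orthogonal_matrix_def)
  then show ?thesis
    by (simp add: norm_orthogonal_mult_right norm_orthogonal_mult_left assms(1))
qed

lemma orthogonal_matrix_row_sum:
  assumes "orthogonal_matrix (Q :: real ^ 'n ^ 'n)"
  shows "(\<Sum>j\<in>UNIV. (Q $ i $ j)\<^sup>2) = 1"
proof -
  have "(Q ** transpose Q) $ i $ i = 1"
    using assms by (simp add: orthogonal_matrix_def mat_def)
  then show ?thesis
    by (simp add: matrix_matrix_mult_def transpose_def power2_eq_square)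
qed

lemma orthogonal_matrix_column_sum:
  assumes "orthogonal_matrix (Q :: real ^ 'n ^ 'n)"
  shows "(\<Sum>i\<in>UNIV. (Q $ i $ j)\<^sup>2) = 1"
proof -
  have "orthogonal_matrix (transpose Q)"
    using assms by (simp add: orthogonal_matrix_def)
  from orthogonal_matrix_row_sum[OF this, of j] show ?thesis
    by (simp add: transpose_def)
qed

subsection \<open>Singular values\<close>

lemma diag_mult_left: "(diag d ** A) $ i $ j = d (pos i) * A $ i $ j"
  by (simp add: diag_def matrix_matrix_mult_def if_distrib[of "\<lambda>x. x * _"] cong: if_cong)

lemma diag_mult_right: "(A ** diag d) $ i $ j = A $ i $ j * d (pos j)"
  by (simp add: diag_def matrix_matrix_mult_def if_distrib[of "\<lambda>x. _ * x"] cong: if_cong)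

lemma diag_mult_diag: "diag c ** diag d = diag (\<lambda>i. c i * d i)"
  by (auto simp: vec_eq_iff diag_mult_left) (auto simp: diag_def)

lemma transpose_diag: "transpose (diag d) = diag d"
  by (auto simp: diag_def transpose_def vec_eq_iff)

lemma pos_ge_1: "1 \<le> pos i"
proof -
  have "card {i} \<le> pos i" unfolding pos_def by (rule card_mono) auto
  then show ?thesis by simp
qed

lemma pos_le_card: "pos (i :: 'n::{finite,linorder}) \<le> CARD('n)"
  unfolding pos_def by (rule card_mono) auto

section \<open>Characteristic polynomials of similar and of diagonal matrices\<close>

definition const_mat :: "real ^ 'n ^ 'm \<Rightarrow> real poly ^ 'n ^ 'm" where
  "const_mat M = (\<chi> i j. [:M $ i $ j:])"

lemma const_mat_mult: "const_mat (A ** B) = const_mat A ** const_mat B"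
  by (simp add: const_mat_def matrix_matrix_mult_def vec_eq_iff sum_to_poly mult_to_poly mult.commute)

lemma const_mat_one: "const_mat (mat 1) = mat 1"
  by (simp add: const_mat_def mat_def vec_eq_iff one_pCons)

lemma mat_commute: "mat c ** A = A ** mat (c :: 'a::comm_semiring_1)"
  by (simp add: mat_def matrix_matrix_mult_def vec_eq_iff if_distrib[of "\<lambda>x. _ * x"]
      if_distrib[of "\<lambda>x. x * _"] cong: if_cong) (simp add: mult.commute)

text \<open>Scalar matrices commute with everything and \<open>const_mat\<close> is multiplicative,
  so the whole polynomial matrix of \<open>M\<close> is conjugated by constant matrices whose
  determinants multiply to 1.\<close>

lemma charpoly_similar:
  fixes P Q M :: "'n::finite sqmat"
  assumes "P ** Q = mat 1"
  shows "charpoly (P ** M ** Q) = charpoly M"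
proof -
  have PQ: "const_mat P ** const_mat Q = mat 1"
    by (metis assms const_mat_mult const_mat_one)
  have "mat [:0, 1:] - const_mat (P ** M ** Q)
      = const_mat P ** (mat [:0, 1:] - const_mat M) ** const_mat Q"
    by (simp add: matrix_sub_ldistrib matrix_sub_rdistrib const_mat_mult
        flip: mat_commute matrix_mul_assoc) (simp add: PQ)
  then have "charpoly (P ** M ** Q) = det (const_mat P) * charpoly M * det (const_mat Q)"
    by (simp add: charpoly_def det_mul flip: const_mat_def)
  also have "\<dots> = det (const_mat P ** const_mat Q) * charpoly M"
    by (simp add: det_mul)
  finally show ?thesis by (simp add: PQ)
qed

lemma charpoly_diag: "charpoly (diag d :: ('n::{finite,linorder}) sqmat) = (\<Prod>i\<in>(UNIV::'n set). [:- d (pos i), 1:])"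
  unfolding charpoly_def by (subst det_diagonal) (auto simp: mat_def diag_def)

lemma proots_charpoly_diag:
  "proots (charpoly (diag d :: ('n::{finite,linorder}) sqmat)) = image_mset (\<lambda>i. d (pos i)) (mset_set (UNIV :: 'n set))"
  unfolding charpoly_diag by (subst proots_prod) (auto simp: sum_unfold_sum_mset)

context
  fixes M U V :: "('n::{finite,linorder}) sqmat"
  assumes svd: "is_svd M U V"
begin

text \<open>The factor \<open>U\<close> cancels in \<open>transpose M ** M\<close>, leaving a matrix
  similar to the diagonal of the squares. The point is that the multiset behind
  \<open>\<alpha> M\<close> therefore has exactly n members, all nonnegative, which its definition
  through polynomial roots does not show.\<close>

lemma singular_values_from_svd:
  "image_mset sqrt (proots (charpoly (transpose M ** M)))
    = image_mset (\<lambda>i. \<bar>\<alpha> M (pos i)\<bar>) (mset_set (UNIV :: 'n set))"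
proof -
  have U: "U ** transpose U = mat 1" and V: "transpose V ** V = mat 1"
    and M: "M = transpose U ** diag (\<alpha> M) ** V"
    using svd by (auto simp: is_svd_def orthogonal_matrix_def)
  have "transpose M ** M = transpose V ** diag (\<alpha> M) ** (U ** transpose U) ** diag (\<alpha> M) ** V"
    by (subst (1 2) M) (simp add: matrix_transpose_mul transpose_diag matrix_mul_assoc)
  also have "\<dots> = transpose V ** diag (\<lambda>i. (\<alpha> M i)\<^sup>2) ** V"
    by (simp add: U power2_eq_square flip: diag_mult_diag) (simp add: matrix_mul_assoc)
  finally show ?thesis
    by (simp add: charpoly_similar[OF V] proots_charpoly_diag multiset.map_comp comp_def)
qed

lemma \<alpha>_nonneg_antimono:
  assumes "1 \<le> i" "i \<le> j" "j \<le> CARD('n)"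
  shows "0 \<le> \<alpha> M j" "\<alpha> M j \<le> \<alpha> M i"
proof -
  define m where "m = image_mset sqrt (proots (charpoly (transpose M ** M)))"
  \<comment> \<open>With n entries in the list, the indices 1, ..., n all refer to actual list
    members.\<close>
  have len: "length (sorted_list_of_multiset m) = CARD('n)"
    by (simp add: m_def singular_values_from_svd flip: size_mset)
  have \<alpha>: "\<alpha> M l = rev (sorted_list_of_multiset m) ! (l - 1)" for l
    by (simp add: \<alpha>_def m_def)
  have "\<alpha> M j \<in> set (rev (sorted_list_of_multiset m))"
    unfolding \<alpha> using assms len by (intro nth_mem) auto
  then show "0 \<le> \<alpha> M j"
    by (auto simp: m_def singular_values_from_svd)
  show "\<alpha> M j \<le> \<alpha> M i"
    unfolding \<alpha> using assms len
    by (intro sorted_rev_nth_mono) auto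
qed

end

subsection \<open>Square roots and the Lyapunov equation\<close>

text \<open>Pairing the equation with \<open>X\<close> under the trace gives a sum of two terms, one
  for \<open>q\<close> and one for \<open>r\<close>, each positive unless \<open>X = 0\<close>. It
  serves both the uniqueness of square roots and the Lyapunov equation.\<close>

lemma sylvester_unique:
  assumes q: "spd q" and r: "spd r" and X: "q ** X + X ** r = (0 :: 'n::finite sqmat)"
  shows "X = 0"
proof -
  \<comment> \<open>The diagonal entries are the values of the quadratic form of \<open>s\<close> at
    the columns of \<open>Y\<close>, which gives the positivity of the trace.\<close>
  have gram: "transpose Y ** s ** Y = (\<chi> i j. column i Y \<bullet> (s *v column j Y))" for Y s :: "'n sqmat"
    by (simp add: vec_eq_iff matrix_matrix_mult_def transpose_def column_def inner_vec_def
        matrix_vector_mult_def sum_distrib_left sum_distrib_right mult_ac)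
      (intro allI, subst sum.swap, simp add: mult_ac)
  have pos: "0 < trace (transpose Y ** s ** Y)" if s: "spd s" and Y: "Y \<noteq> 0" for Y s :: "'n sqmat"
  proof -
    have nonneg: "0 \<le> column i Y \<bullet> (s *v column i Y)" for i
      using s by (cases "column i Y = 0") (auto simp: spd_def less_imp_le)
    obtain i where "column i Y \<noteq> 0"
      using Y by (auto simp: vec_eq_iff column_def)
    then have "0 < column i Y \<bullet> (s *v column i Y)"
      using s by (auto simp: spd_def)
    then have "0 < (\<Sum>i\<in>UNIV. column i Y \<bullet> (s *v column i Y))"
      using nonneg by (intro sum_pos2[of _ i]) auto
    then show ?thesis
      by (simp add: gram trace_def)
  qed
  have "trace (transpose X ** q ** X) + trace (X ** r ** transpose X)
      = trace (transpose X ** (q ** X)) + trace (transpose X ** (X ** r))"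
    by (metis matrix_mul_assoc trace_mul_sym)
  also have "\<dots> = trace (transpose X ** (q ** X + X ** r))"
    by (simp add: matrix_add_ldistrib trace_add)
  also have "\<dots> = 0"
    by (simp add: X) (simp add: trace_def matrix_matrix_mult_def)
  finally have "trace (transpose X ** q ** X) + trace (X ** r ** transpose X) = 0" .
  then show ?thesis
    using pos[OF q, of X] pos[OF r, of "transpose X"]
    by (metis add_pos_pos less_irrefl transpose_iff transpose_transpose transpose_mat mat_0)
qed

lemma spd_invertible:
  assumes "spd q"
  shows "invertible q"
proof -
  have "v = 0" if "q *v v = 0" for v
    using assms that unfolding spd_def by (metis inner_zero_right less_irrefl)
  then show ?thesis
    by (simp add: invertible_left_inverse matrix_left_invertible_ker)
qed

section \<open>Spectral theorem for real symmetric matrices\<close>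

lemma inner_sym_mat:
  assumes "A \<in> sym_mats"
  shows "(A *v v) \<bullet> w = v \<bullet> (A *v w)"
proof -
  have "(transpose A *v v) \<bullet> w = v \<bullet> (A *v w)"
    by (simp add: dot_lmul_matrix)
  then show ?thesis
    using assms unfolding sym_mats_def mem_Collect_eq by (simp only:)
qed

text \<open>The quadratic form of \<open>A\<close> attains its maximum on the compact unit sphere of
  \<open>S\<close>, and a maximiser is an eigenvector.\<close>

lemma symmetric_eigenvector_exists:
  fixes A :: "'n::finite sqmat"
  assumes "A \<in> sym_mats" "subspace S" "\<And>v. v \<in> S \<Longrightarrow> A *v v \<in> S" "S \<noteq> {0}"
  obtains b l where "b \<in> S" "norm b = 1" "A *v b = l *\<^sub>R b"
proof -
  have sa: "(A *v v) \<bullet> w = v \<bullet> (A *v w)" for v w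
    using inner_sym_mat[OF assms(1)] .
  let ?K = "sphere 0 1 \<inter> S"
  have K: "compact ?K"
    using assms(2) by (simp add: closed_subspace compact_Int_closed)
  obtain v where "v \<in> S" "v \<noteq> 0"
    using assms(2,4) subspace_0 by auto
  then have "v /\<^sub>R norm v \<in> ?K"
    using assms(2) by (simp add: subspace_scale)
  then have ne: "?K \<noteq> {}" by blast
  have "continuous_on ?K (\<lambda>v. v \<bullet> (A *v v))"
    by (intro continuous_intros linear_continuous_on) auto
  from continuous_attains_sup[OF K ne this] obtain b where b: "b \<in> ?K"
    and max: "\<And>v. v \<in> ?K \<Longrightarrow> v \<bullet> (A *v v) \<le> b \<bullet> (A *v b)" by blast
  define l where "l = b \<bullet> (A *v b)"
  \<comment> \<open>The residual of the eigenvalue equation: it stays in \<open>S\<close> by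
    invariance and is orthogonal to \<open>b\<close> by the choice of \<open>l\<close>. The goal is
    \<open>w = 0\<close>.\<close>
  define w where "w = A *v b - l *\<^sub>R b"
  have bS: "b \<in> S" and nb: "norm b = 1" using b by auto
  have wS: "w \<in> S"
    using assms bS by (simp add: w_def subspace_diff subspace_scale)
  have bb: "b \<bullet> b = 1" using nb by (simp add: dot_square_norm)
  have wb: "w \<bullet> b = 0"
    by (simp add: w_def inner_diff_left bb l_def inner_commute[of "A *v b"])
  \<comment> \<open>Homogeneity extends the maximum from the unit sphere to all of
    \<open>S\<close>.\<close>
  have bound: "v \<bullet> (A *v v) \<le> l * (v \<bullet> v)" if "v \<in> S" for v
  proof (cases "v = 0")
    case False
    have "v /\<^sub>R norm v \<in> ?K"
      using assms(2) that False by (simp add: subspace_scale)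
    from max[OF this] have "(v \<bullet> (A *v v)) / (norm v)\<^sup>2 \<le> l"
      by (simp add: matrix_vector_mult_scaleR l_def power2_eq_square divide_simps)
    then show ?thesis
      using False by (simp add: power2_norm_eq_inner divide_le_eq)
  qed simp
  text \<open>The form \<open>l |v|\<^sup>2 - v \<bullet> A v\<close> is nonnegative on \<open>S\<close> and vanishes at \<open>b\<close>, so its
    first variation at \<open>b\<close> in direction \<open>w\<close> vanishes.\<close>
  define c where "c = w \<bullet> (A *v w) - l * (w \<bullet> w)"
  have quad: "2 * t * (w \<bullet> w) + t\<^sup>2 * c \<le> 0" for t
  proof -
    have "A *v b = w + l *\<^sub>R b" by (simp add: w_def)
    then have "(A *v b) \<bullet> w = w \<bullet> w"
      using wb by (simp add: inner_add_left inner_commute[of b])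
    then have bAw: "b \<bullet> (A *v w) = w \<bullet> w"
      by (simp only: sa)
    have "b + t *\<^sub>R w \<in> S"
      using assms(2) bS wS by (simp add: subspace_add subspace_scale)
    from bound[OF this] have "(b + t *\<^sub>R w) \<bullet> (A *v b + t *\<^sub>R (A *v w)) \<le> l * ((b + t *\<^sub>R w) \<bullet> (b + t *\<^sub>R w))"
      by (simp add: matrix_vector_right_distrib matrix_vector_mult_scaleR)
    moreover have "w \<bullet> (A *v b) = w \<bullet> w"
      using sa[of b w] bAw by (metis inner_commute)
    ultimately show ?thesis
      using wb bAw bb
      by (simp add: c_def inner_add_left inner_add_right inner_commute[of b w] algebra_simps
          power2_eq_square flip: l_def)
  qed
  have "w \<bullet> w = 0"
  proof (rule ccontr)
    assume "w \<bullet> w \<noteq> 0"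
    then have ww: "0 < w \<bullet> w" by simp
    \<comment> \<open>This \<open>t\<close> is small enough for the linear term of
      \<open>quad\<close> to dominate the quadratic one; the added 1 covers
      \<open>c = 0\<close>.\<close>
    define t where "t = (w \<bullet> w) / (\<bar>c\<bar> + 1)"
    have t: "0 < t" "t * (\<bar>c\<bar> + 1) = w \<bullet> w" using ww by (auto simp: t_def)
    have "t * \<bar>c\<bar> \<le> w \<bullet> w"
      using t by (simp add: algebra_simps)
    moreover have "- (t * \<bar>c\<bar>) \<le> t * c"
      using t(1) mult_left_mono[of "- \<bar>c\<bar>" c t] by simp
    ultimately have "- (w \<bullet> w) \<le> t * c" by linarith
    then have "0 < t * (2 * (w \<bullet> w) + t * c)"
      using t(1) ww by (intro mult_pos_pos) linarith+
    then show False
      using quad[of t] by (simp add: algebra_simps power2_eq_square)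
  qed
  then have "A *v b = l *\<^sub>R b" by (simp add: w_def)
  with bS nb show ?thesis by (rule that)
qed

text \<open>Induction on the dimension: split off one unit eigenvector \<open>b\<close>. By symmetry
  of \<open>A\<close>, the orthogonal complement of \<open>b\<close> within \<open>S\<close> is
  again invariant.\<close>

lemma symmetric_orthonormal_eigenbasis:
  fixes A :: "'n::finite sqmat"
  assumes "A \<in> sym_mats" "subspace S" "\<And>v. v \<in> S \<Longrightarrow> A *v v \<in> S"
  shows "\<exists>B. finite B \<and> pairwise orthogonal B \<and> (\<forall>b\<in>B. norm b = 1 \<and> (\<exists>l. A *v b = l *\<^sub>R b)) \<and> span B = S"
  using assms(2,3)
proof (induction "dim S" arbitrary: S rule: less_induct)
  case less
  show ?case
  proof (cases "S = {0}")
    case True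
    then show ?thesis by (intro exI[of _ "{}"]) auto
  next
    case False
    obtain b l where b: "b \<in> S" "norm b = 1" "A *v b = l *\<^sub>R b"
      using symmetric_eigenvector_exists[OF assms(1) less.prems False] .
    define T where "T = {v \<in> S. b \<bullet> v = 0}"
    have T: "subspace T"
      using less.prems(1) by (auto simp: T_def subspace_def inner_add_right)
    have bb: "b \<bullet> b = 1" using b by (simp add: dot_square_norm)
    then have "b \<notin> T" by (simp add: T_def)
    moreover have "T \<subseteq> S" by (auto simp: T_def)
    ultimately have "T \<subset> S" using b(1) by blast
    then have "dim T < dim S"
      using T less.prems(1) by (intro dim_psubset) (simp add: span_eq_iff[THEN iffD2])
    moreover have "A *v v \<in> T" if "v \<in> T" for v
    proof -
      have "b \<bullet> (A *v v) = (A *v b) \<bullet> v"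
        using inner_sym_mat[OF assms(1)] by simp
      then show ?thesis
        using that less.prems(2) b by (simp add: T_def)
    qed
    ultimately obtain B where B: "finite B" "pairwise orthogonal B"
      "\<forall>b\<in>B. norm b = 1 \<and> (\<exists>l. A *v b = l *\<^sub>R b)" "span B = T"
      using less.hyps[OF _ T] by blast
    have "v \<in> span (insert b B)" if "v \<in> S" for v
    proof -
      have "v - (b \<bullet> v) *\<^sub>R b \<in> T"
        using that b less.prems(1) bb
        by (simp add: T_def subspace_diff subspace_scale inner_diff_right)
      then show ?thesis
        using B(4) by (auto simp: span_breakdown_eq)
    qed
    moreover have "span (insert b B) \<subseteq> S"
      using b B(4) less.prems(1) span_superset[of B]
      by (intro span_minimal) (auto simp: T_def)
    moreover have "pairwise orthogonal (insert b B)"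
      using B(2,4) span_superset[of B]
      by (auto simp: pairwise_insert T_def orthogonal_def inner_commute)
    ultimately show ?thesis
      using B b by (intro exI[of _ "insert b B"]) auto
  qed
qed

text \<open>Take square roots of the eigenvalues in an orthonormal eigenbasis of
  \<open>p\<close>.\<close>

lemma spd_sqrt_exists:
  assumes p: "spd (p :: 'n::finite sqmat)"
  shows "\<exists>q. spd q \<and> q ** q = p"
proof -
  have psym: "p \<in> sym_mats" using p by (simp add: spd_def)
  obtain B where B: "finite B" "pairwise orthogonal B" "span B = (UNIV :: 'n rvec set)"
    and n: "\<And>b. b \<in> B \<Longrightarrow> norm b = 1" and ev: "\<forall>b\<in>B. \<exists>l. p *v b = l *\<^sub>R b"
    using symmetric_orthonormal_eigenbasis[OF psym subspace_UNIV] by auto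
  from ev obtain l where l: "\<And>b. b \<in> B \<Longrightarrow> p *v b = l b *\<^sub>R b" by metis
  have orth: "b \<bullet> c = (if b = c then 1 else 0)" if "b \<in> B" "c \<in> B" for b c
    using B(2) n that by (auto simp: pairwise_def orthogonal_def dot_square_norm)
  have lpos: "0 < l b" if "b \<in> B" for b
  proof -
    have "b \<noteq> 0" using n[OF that] by auto
    then have "0 < b \<bullet> (p *v b)" using p by (simp add: spd_def)
    then show ?thesis using l[OF that] orth[OF that that] by simp
  qed
  define f where "f v = (\<Sum>b\<in>B. (sqrt (l b) * (b \<bullet> v)) *\<^sub>R b)" for v
  have lin: "linear f"
    unfolding f_def
    by (intro linear_compose_sum ballI linearI)
      (auto simp: inner_add_right algebra_simps)
  define q where "q = matrix f"
  have q: "q *v v = f v" for v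
    by (simp add: q_def matrix_works lin)
  have fb: "f b = sqrt (l b) *\<^sub>R b" if "b \<in> B" for b
  proof -
    have "f b = (\<Sum>c\<in>B. if c = b then sqrt (l b) *\<^sub>R b else 0)"
      unfolding f_def using that by (intro sum.cong) (auto simp: orth)
    then show ?thesis using that B(1) by simp
  qed
  have "(q ** q) *v v = p *v v" for v
  proof -
    have "v \<in> span B" using B(3) by simp
    then show ?thesis
    proof (rule linear_eq_on_span[rotated 3])
      fix b assume b: "b \<in> B"
      show "(q ** q) *v b = p *v b"
        using lpos[OF b]
        by (simp add: q fb[OF b] l[OF b] linear_scale[OF lin] flip: matrix_vector_mul_assoc)
    qed auto
  qed
  then have qq: "q ** q = p" by (simp add: matrix_eq)
  have f_sym: "v \<bullet> f w = f v \<bullet> w" for v w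
    unfolding f_def inner_sum_left inner_sum_right
    by (intro sum.cong) (simp_all add: inner_commute[of v])
  have "transpose q *v v = q *v v" for v
  proof (rule vector_eq_rdot[THEN iffD1], rule allI)
    fix w
    have "(transpose q *v v) \<bullet> w = v \<bullet> (q *v w)"
      by (simp add: dot_lmul_matrix)
    then show "(transpose q *v v) \<bullet> w = (q *v v) \<bullet> w"
      by (simp only: q f_sym)
  qed
  then have "transpose q = q"
    by (simp only: matrix_eq) simp
  moreover have "0 < v \<bullet> (q *v v)" if "v \<noteq> 0" for v
  proof -
    have eq: "v \<bullet> (q *v v) = (\<Sum>b\<in>B. sqrt (l b) * (b \<bullet> v)\<^sup>2)"
      unfolding q f_def inner_sum_right
      by (intro sum.cong) (simp_all add: inner_commute[of v] power2_eq_square)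
    \<comment> \<open>A vector orthogonal to all of \<open>B\<close> is orthogonal to the whole
      space, hence to itself.\<close>
    have "\<exists>b\<in>B. b \<bullet> v \<noteq> 0"
    proof (rule ccontr)
      assume "\<not> (\<exists>b\<in>B. b \<bullet> v \<noteq> 0)"
      then have "orthogonal v b" if "b \<in> B" for b
        using that by (simp add: orthogonal_def inner_commute)
      then have "orthogonal v v"
        using B(3) orthogonal_to_span[of v B v] by blast
      then show False using \<open>v \<noteq> 0\<close> by (simp add: orthogonal_self)
    qed
    then obtain b where "b \<in> B" "b \<bullet> v \<noteq> 0" by blast
    then show ?thesis
      unfolding eq using B(1) lpos
      by (intro sum_pos2[of _ b]) (auto simp: less_imp_le)
  qed
  ultimately show ?thesis
    using qq by (auto simp: spd_def sym_mats_def)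
qed

text \<open>\<open>q ** (q - r) + (q - r) ** r\<close> telescopes to the difference of the squares
  even if \<open>q\<close> and \<open>r\<close> do not commute, so the difference solves a
  homogeneous Sylvester equation.\<close>

lemma spd_sqrt_unique:
  assumes "spd q" "spd r" "q ** q = r ** r"
  shows "q = r"
proof -
  have "q ** (q - r) + (q - r) ** r = 0"
    using assms(3) by (simp add: matrix_sub_ldistrib matrix_sub_rdistrib)
  from sylvester_unique[OF assms(1,2) this] show ?thesis by simp
qed

lemma msqrt:
  assumes "spd p"
  shows "spd (msqrt p)" "msqrt p ** msqrt p = p"
proof -
  have "\<exists>!q. spd q \<and> q ** q = p"
    using spd_sqrt_exists[OF assms] spd_sqrt_unique by blast
  from theI'[OF this] show "spd (msqrt p)" "msqrt p ** msqrt p = p"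
    by (auto simp: msqrt_def)
qed

text \<open>The Lyapunov operator is injective, hence surjective in finite dimension. The transpose
  of a solution solves the same equation, so the solution is symmetric.\<close>

lemma lyapunov:
  assumes p: "spd p" and e: "e \<in> sym_mats"
  shows "lyapunov p e \<in> sym_mats" "msqrt p ** lyapunov p e + lyapunov p e ** msqrt p = e"
proof -
  let ?q = "msqrt p"
  let ?L = "\<lambda>X. ?q ** X + X ** ?q"
  note q = msqrt(1)[OF p]
  have qT: "transpose ?q = ?q" using q by (simp add: spd_def sym_mats_def)
  have lin: "linear ?L"
    by (intro linearI) (simp_all add: matrix_matrix_mult_def vec_eq_iff algebra_simps
        sum.distrib sum_distrib_left)
  have inj: "inj ?L"
    unfolding linear_injective_0[OF lin] using sylvester_unique[OF q q] by blast
  have "e \<in> range ?L"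
    using linear_injective_imp_surjective[OF lin inj] by blast
  then obtain X where X: "?L X = e" by blast
  have "?L (transpose X) = transpose (?L X)"
    by (simp add: transpose_add matrix_transpose_mul qT add.commute)
  also have "\<dots> = ?L X" using X e by (simp add: sym_mats_def)
  finally have "transpose X = X" using inj by (meson injD)
  then have "\<exists>!X. X \<in> sym_mats \<and> ?L X = e"
    using X inj by (auto simp: sym_mats_def dest: injD)
  from theI'[OF this] show "lyapunov p e \<in> sym_mats" "?L (lyapunov p e) = e"
    by (auto simp: lyapunov_def)
qed

subsection \<open>Perturbation of singular projections\<close>

text \<open>For orthogonal \<open>U\<close> this is the orthogonal projection onto the span of the
  first \<open>k\<close> rows of \<open>U\<close>; rows, because the decomposition has the form U^T
  D V.\<close>

definition proj_mat :: "nat \<Rightarrow> ('n::{finite,linorder}) sqmat \<Rightarrow> 'n sqmat" where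
  "proj_mat k U = transpose U ** diag (\<lambda>i. if i \<le> k then 1 else 0) ** U"

lemma transpose_proj_mat: "transpose (proj_mat k U) = proj_mat k U"
  by (simp add: proj_mat_def matrix_transpose_mul transpose_diag matrix_mul_assoc)

text \<open>For \<open>L = U ** transpose U'\<close> with orthogonal factors, this is the sum of the
  squared sines of the principal angles between the ranges of the two projections.\<close>

definition low_block :: "nat \<Rightarrow> ('n::{finite,linorder}) sqmat \<Rightarrow> real" where
  "low_block k L = (\<Sum>i\<in>UNIV. \<Sum>j\<in>UNIV. if k < pos i \<and> pos j \<le> k then (L $ i $ j)\<^sup>2 else 0)"

text \<open>Changing to the mixed bases turns the difference of projections into
  \<open>diag \<epsilon> ** L - L ** diag \<epsilon>\<close>, whose entries vanish on the diagonal
  blocks and are those of \<open>L\<close> up to sign on the other two.\<close>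

lemma norm_proj_mat_diff:
  assumes U: "orthogonal_matrix U" and U': "orthogonal_matrix U'"
  shows "(norm (proj_mat k U - proj_mat k U'))\<^sup>2 = 2 * low_block k (U ** transpose U')"
proof -
  define L where "L = U ** transpose U'"
  define \<epsilon> :: "nat \<Rightarrow> real" where "\<epsilon> = (\<lambda>i. if i \<le> k then 1 else 0)"
  have L: "orthogonal_matrix L"
    unfolding L_def by (intro orthogonal_matrix_mul U) (simp add: orthogonal_matrix_transpose U')
  have "U ** (proj_mat k U - proj_mat k U') ** transpose U'
      = (U ** transpose U) ** diag \<epsilon> ** L - L ** diag \<epsilon> ** (U' ** transpose U')"
    by (simp add: proj_mat_def L_def flip: \<epsilon>_def) (simp add: matrix_sub_ldistrib matrix_sub_rdistrib matrix_mul_assoc)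
  also have "\<dots> = diag \<epsilon> ** L - L ** diag \<epsilon>"
    using U U' by (simp add: orthogonal_matrix_def)
  finally have "(norm (proj_mat k U - proj_mat k U'))\<^sup>2 = (norm (diag \<epsilon> ** L - L ** diag \<epsilon>))\<^sup>2"
    by (simp only: norm_orthogonal_conjugate[OF U U', symmetric, of "proj_mat k U - proj_mat k U'"])
  also have "\<dots> = (\<Sum>i\<in>UNIV. \<Sum>j\<in>UNIV. \<epsilon> (pos i) * (L $ i $ j)\<^sup>2 + \<epsilon> (pos j) * (L $ i $ j)\<^sup>2
      - 2 * (\<epsilon> (pos i) * \<epsilon> (pos j) * (L $ i $ j)\<^sup>2))"
    unfolding norm_matrix_sq
    by (intro sum.cong) (auto simp: diag_mult_left diag_mult_right \<epsilon>_def)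
  also have "\<dots> = (\<Sum>i\<in>UNIV. \<Sum>j\<in>UNIV. \<epsilon> (pos i) * (L $ i $ j)\<^sup>2)
      + (\<Sum>i\<in>UNIV. \<Sum>j\<in>UNIV. \<epsilon> (pos j) * (L $ i $ j)\<^sup>2)
      - 2 * (\<Sum>i\<in>UNIV. \<Sum>j\<in>UNIV. \<epsilon> (pos i) * \<epsilon> (pos j) * (L $ i $ j)\<^sup>2)"
    by (simp add: sum.distrib sum_subtractf sum_distrib_left)
  text \<open>Both projections have the same rank, so the two off-diagonal blocks of \<open>L\<close> have equal norm;
    only one of them is controlled by the gap.\<close>
  also have "(\<Sum>i\<in>UNIV. \<Sum>j\<in>UNIV. \<epsilon> (pos i) * (L $ i $ j)\<^sup>2)
      = (\<Sum>i\<in>UNIV. \<Sum>j\<in>UNIV. \<epsilon> (pos j) * (L $ i $ j)\<^sup>2)"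
  proof -
    have "(\<Sum>i\<in>UNIV. \<Sum>j\<in>UNIV. \<epsilon> (pos j) * (L $ i $ j)\<^sup>2)
        = (\<Sum>j\<in>UNIV. \<epsilon> (pos j) * (\<Sum>i\<in>UNIV. (L $ i $ j)\<^sup>2))"
      unfolding sum_distrib_left by (rule sum.swap)
    moreover have "(\<Sum>i\<in>UNIV. \<Sum>j\<in>UNIV. \<epsilon> (pos i) * (L $ i $ j)\<^sup>2)
        = (\<Sum>i\<in>UNIV. \<epsilon> (pos i) * (\<Sum>j\<in>UNIV. (L $ i $ j)\<^sup>2))"
      unfolding sum_distrib_left ..
    ultimately show ?thesis
      by (simp add: orthogonal_matrix_row_sum[OF L] orthogonal_matrix_column_sum[OF L])
  qed
  also have "\<dots> + (\<Sum>i\<in>UNIV. \<Sum>j\<in>UNIV. \<epsilon> (pos j) * (L $ i $ j)\<^sup>2)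
      - 2 * (\<Sum>i\<in>UNIV. \<Sum>j\<in>UNIV. \<epsilon> (pos i) * \<epsilon> (pos j) * (L $ i $ j)\<^sup>2)
      = 2 * (\<Sum>i\<in>UNIV. \<Sum>j\<in>UNIV. \<epsilon> (pos j) * (L $ i $ j)\<^sup>2 - \<epsilon> (pos i) * \<epsilon> (pos j) * (L $ i $ j)\<^sup>2)"
    by (simp add: sum_subtractf)
  also have "\<dots> = 2 * low_block k L"
    \<comment> \<open>The weight left on each squared entry is
      \<open>\<epsilon> (pos j) * (1 - \<epsilon> (pos i))\<close>, the indicator of the lower
      block.\<close>
    unfolding low_block_def by (intro arg_cong[of _ _ "(*) 2"] sum.cong) (auto simp: \<epsilon>_def)
  finally show ?thesis unfolding L_def .
qed

text \<open>The right side equals \<open>(d - c)\<^sup>2 * (a\<^sup>2 + b\<^sup>2)\<close> plus the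
  nonnegative term \<open>2 * c * d * (a - b)\<^sup>2\<close>. Both residuals are needed, since
  either alone can vanish for nonzero \<open>a\<close> and \<open>b\<close>.\<close>

lemma gap_inequality:
  fixes a b c d \<delta> :: real
  assumes "0 \<le> c" "0 \<le> \<delta>" "c + \<delta> \<le> d"
  shows "\<delta>\<^sup>2 * (a\<^sup>2 + b\<^sup>2) \<le> (c * b - a * d)\<^sup>2 + (c * a - b * d)\<^sup>2"
proof -
  have "\<delta>\<^sup>2 * (a\<^sup>2 + b\<^sup>2) \<le> (d - c)\<^sup>2 * (a\<^sup>2 + b\<^sup>2)"
    using assms by (intro mult_right_mono power_mono) auto
  also have "\<dots> \<le> (d - c)\<^sup>2 * (a\<^sup>2 + b\<^sup>2) + 2 * c * d * (a - b)\<^sup>2"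
    using assms by simp
  also have "\<dots> = (c * b - a * d)\<^sup>2 + (c * a - b * d)\<^sup>2"
    by algebra
  finally show ?thesis .
qed

text \<open>Rows beyond \<open>k\<close> carry singular values of \<open>M\<close>, columns up to
  \<open>k\<close> those of \<open>N\<close>, so monotonicity reduces every such pair to the one gap
  \<open>\<delta>\<close>. The factor 2 counts the residual and its transposed counterpart, each of
  norm \<open>norm (M - N)\<close>.\<close>

lemma low_block_gap:
  fixes M N :: "('n::{finite,linorder}) sqmat"
  assumes M: "is_svd M U V" and N: "is_svd N U' V'" and k: "1 \<le> k" "k < CARD('n)"
    and \<delta>: "\<delta> = \<alpha> N k - \<alpha> M (k + 1)" "0 < \<delta>"
  shows "\<delta>\<^sup>2 * (low_block k (U ** transpose U') + low_block k (V ** transpose V'))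
      \<le> 2 * (norm (M - N))\<^sup>2"
proof -
  define L R where "L = U ** transpose U'" and "R = V ** transpose V'"
  have orth: "orthogonal_matrix U" "orthogonal_matrix V"
      "orthogonal_matrix U'" "orthogonal_matrix V'"
    using M N by (auto simp: is_svd_def)
  have one: "U ** transpose U = mat 1" "V ** transpose V = mat 1"
      "U' ** transpose U' = mat 1" "V' ** transpose V' = mat 1"
    using M N by (auto simp: is_svd_def orthogonal_matrix_def)
  have Meq: "M = transpose U ** diag (\<alpha> M) ** V" and Neq: "N = transpose U' ** diag (\<alpha> N) ** V'"
    using M N by (auto simp: is_svd_def)
  have "U ** (M - N) ** transpose V'
      = (U ** transpose U) ** diag (\<alpha> M) ** R - L ** diag (\<alpha> N) ** (V' ** transpose V')"
    by (subst Meq, subst Neq)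
      (simp only: L_def R_def matrix_sub_ldistrib matrix_sub_rdistrib matrix_mul_assoc)
  then have E: "norm (M - N) = norm (diag (\<alpha> M) ** R - L ** diag (\<alpha> N))"
    by (simp only: one matrix_mul_lid matrix_mul_rid
        norm_orthogonal_conjugate[OF orth(1,4), symmetric, of "M - N"])
  \<comment> \<open>Transposition exchanges the roles of \<open>L\<close> and \<open>R\<close> and
    supplies the second residual.\<close>
  have "V ** transpose (M - N) ** transpose U'
      = (V ** transpose V) ** diag (\<alpha> M) ** L - R ** diag (\<alpha> N) ** (U' ** transpose U')"
    by (subst Meq, subst Neq)
      (simp only: L_def R_def matrix_sub_ldistrib matrix_sub_rdistrib matrix_mul_assoc transpose_diff
        matrix_transpose_mul transpose_diag transpose_transpose)
  then have E': "norm (M - N) = norm (diag (\<alpha> M) ** L - R ** diag (\<alpha> N))"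
    by (simp only: one matrix_mul_lid matrix_mul_rid norm_transpose[of "M - N", symmetric]
        norm_orthogonal_conjugate[OF orth(2,3), symmetric, of "transpose (M - N)"])
  have "\<delta>\<^sup>2 * (low_block k L + low_block k R)
      = (\<Sum>i\<in>UNIV. \<Sum>j\<in>UNIV. if k < pos i \<and> pos j \<le> k
          then \<delta>\<^sup>2 * ((L $ i $ j)\<^sup>2 + (R $ i $ j)\<^sup>2) else 0)"
    by (simp add: low_block_def sum_distrib_left flip: sum.distrib)
      (intro sum.cong, auto simp: algebra_simps)
  also have "\<dots> \<le> (\<Sum>i\<in>UNIV. \<Sum>j\<in>UNIV. ((diag (\<alpha> M) ** R - L ** diag (\<alpha> N)) $ i $ j)\<^sup>2
      + ((diag (\<alpha> M) ** L - R ** diag (\<alpha> N)) $ i $ j)\<^sup>2)"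
  proof (intro sum_mono)
    fix i j :: 'n
    show "(if k < pos i \<and> pos j \<le> k then \<delta>\<^sup>2 * ((L $ i $ j)\<^sup>2 + (R $ i $ j)\<^sup>2) else 0)
        \<le> ((diag (\<alpha> M) ** R - L ** diag (\<alpha> N)) $ i $ j)\<^sup>2
          + ((diag (\<alpha> M) ** L - R ** diag (\<alpha> N)) $ i $ j)\<^sup>2"
    proof (cases "k < pos i \<and> pos j \<le> k")
      case True
      \<comment> \<open>The bounds on \<open>pos\<close> keep every index within 1, ..., n, where
        \<open>\<alpha>\<close> is meaningful and monotone.\<close>
      have "0 \<le> \<alpha> M (pos i)" "\<alpha> M (pos i) \<le> \<alpha> M (k + 1)" "\<alpha> N k \<le> \<alpha> N (pos j)"
        using True k \<alpha>_nonneg_antimono[OF M, of "k + 1" "pos i"] \<alpha>_nonneg_antimono[OF N, of "pos j" k]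
          pos_le_card[of i] pos_ge_1[of j] by auto
      then have "\<delta>\<^sup>2 * ((L $ i $ j)\<^sup>2 + (R $ i $ j)\<^sup>2)
          \<le> (\<alpha> M (pos i) * R $ i $ j - L $ i $ j * \<alpha> N (pos j))\<^sup>2
            + (\<alpha> M (pos i) * L $ i $ j - R $ i $ j * \<alpha> N (pos j))\<^sup>2"
        using \<delta> by (intro gap_inequality) auto
      then show ?thesis
        using True by (simp add: diag_mult_left diag_mult_right)
    qed auto
  qed
  also have "\<dots> = 2 * (norm (M - N))\<^sup>2"
    unfolding sum.distrib norm_matrix_sq[symmetric] E[symmetric] E'[symmetric] by simp
  finally show ?thesis unfolding L_def R_def .
qed

text \<open>The 8 is a product of three factors 2: from squaring a sum of two norms, from
  \<open>norm_proj_mat_diff\<close>, and from the two residuals in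
  \<open>low_block_gap\<close>.\<close>

lemma norm_proj_mat_gap:
  fixes M N :: "('n::{finite,linorder}) sqmat"
  assumes M: "is_svd M U V" and N: "is_svd N U' V'" and k: "1 \<le> k" "k < CARD('n)"
    and \<delta>: "\<delta> = \<alpha> N k - \<alpha> M (k + 1)" "0 < \<delta>"
  shows "norm ((proj_mat k U - proj_mat k V) - (proj_mat k U' - proj_mat k V'))
      \<le> sqrt 8 / \<delta> * norm (M - N)"
proof (rule power2_le_imp_le)
  let ?P = "proj_mat k U - proj_mat k U'" and ?Q = "proj_mat k V - proj_mat k V'"
  have orth: "orthogonal_matrix U" "orthogonal_matrix V" "orthogonal_matrix U'" "orthogonal_matrix V'"
    using M N by (auto simp: is_svd_def)
  \<comment> \<open>Regroup so that left projections are compared with left ones and right with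
    right.\<close>
  have "(norm ((proj_mat k U - proj_mat k V) - (proj_mat k U' - proj_mat k V')))\<^sup>2 = (norm (?P - ?Q))\<^sup>2"
    by (simp add: algebra_simps)
  also have "\<dots> \<le> (norm ?P + norm ?Q)\<^sup>2"
    by (intro power_mono norm_triangle_ineq4) simp
  also have "\<dots> \<le> 2 * ((norm ?P)\<^sup>2 + (norm ?Q)\<^sup>2)"
    using sum_squares_bound[of "norm ?P" "norm ?Q"] by (simp add: power2_sum)
  also have "\<dots> = 4 * (low_block k (U ** transpose U') + low_block k (V ** transpose V'))"
    using orth by (simp add: norm_proj_mat_diff)
  also have "\<dots> \<le> 4 * (2 * (norm (M - N))\<^sup>2 / \<delta>\<^sup>2)"
    by (rule mult_left_mono, subst pos_le_divide_eq)
      (use low_block_gap[OF M N k \<delta>] \<delta>(2) in \<open>simp_all add: mult.commute\<close>)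
  also have "\<dots> = (sqrt 8 / \<delta> * norm (M - N))\<^sup>2"
    by (simp add: power_mult_distrib power_divide)
  finally show "(norm ((proj_mat k U - proj_mat k V) - (proj_mat k U' - proj_mat k V')))\<^sup>2
      \<le> (sqrt 8 / \<delta> * norm (M - N))\<^sup>2" .
qed (use \<delta> in auto)

subsection \<open>The subgradient candidate\<close>

lemma matrix_inv_mult:
  assumes "invertible A"
  shows "A ** matrix_inv A = mat 1" "matrix_inv A ** A = mat 1"
  using someI_ex[OF assms[unfolded invertible_def]] by (auto simp: matrix_inv_def)

text \<open>The sum \<open>s\<close> is the projection of \<open>W\<close>, so
  \<open>s \<bullet> s = W \<bullet> s\<close>, and Cauchy-Schwarz finishes.\<close>

lemma bessel_norm:
  fixes B :: "'a set"
  assumes "\<And>v w. v \<in> B \<Longrightarrow> w \<in> B \<Longrightarrow> T v \<bullet> T w = (if v = w then 1 else 0)"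
  shows "norm (\<Sum>b\<in>B. (W \<bullet> T b) *\<^sub>R (T b :: 'b::real_inner)) \<le> norm W"
\<comment> \<open>Over an infinite \<open>B\<close> the sum is 0 by convention.\<close>
proof (cases "finite B")
  case True
  define s where "s = (\<Sum>b\<in>B. (W \<bullet> T b) *\<^sub>R T b)"
  have sT: "s \<bullet> T b = W \<bullet> T b" if "b \<in> B" for b
  proof -
    have "s \<bullet> T b = (\<Sum>c\<in>B. if c = b then W \<bullet> T b else 0)"
      unfolding s_def inner_sum_left using that by (intro sum.cong) (auto simp: assms)
    then show ?thesis using that True by simp
  qed
  have "s \<bullet> s = (\<Sum>b\<in>B. (W \<bullet> T b) * (s \<bullet> T b))"
    by (subst (2) s_def) (simp add: inner_sum_right)
  also have "\<dots> = (\<Sum>b\<in>B. (W \<bullet> T b) * (W \<bullet> T b))"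
    by (intro sum.cong) (simp_all add: sT)
  also have "\<dots> = W \<bullet> s"
    by (simp add: s_def inner_sum_right)
  also have "\<dots> \<le> norm W * norm s" by (rule norm_cauchy_schwarz)
  finally have "norm s * norm s \<le> norm W * norm s"
    by (simp add: dot_square_norm power2_eq_square)
  then show ?thesis
    unfolding s_def[symmetric] by (cases "s = 0") simp_all
qed simp

section \<open>Transfer from the inner product of \<open>p\<close> to the Frobenius inner
  product\<close>

context
  fixes p :: "('n::{finite,linorder}) sqmat" and q r
  assumes p: "spd p"
  defines "q \<equiv> msqrt p" and "r \<equiv> msqrt_inv p"
begin

lemma msqrt_inverse: "q ** r = mat 1" "r ** q = mat 1"
  using spd_invertible[OF msqrt(1)[OF p]]
  by (auto simp: q_def r_def msqrt_inv_def matrix_inv_mult)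

lemma transpose_msqrt: "transpose q = q" "transpose r = r"
proof -
  show q: "transpose q = q"
    using msqrt(1)[OF p] by (simp add: q_def spd_def sym_mats_def)
  have "transpose r = transpose r ** (q ** r)" by (simp add: msqrt_inverse)
  also have "\<dots> = transpose (q ** r) ** r"
    by (simp add: matrix_transpose_mul q matrix_mul_assoc)
  finally show "transpose r = r" by (simp add: msqrt_inverse)
qed

lemma matrix_inv_eq_msqrt: "matrix_inv p = r ** r"
proof -
  have "(r ** r) ** p = r ** (r ** q) ** q"
    by (metis matrix_mul_assoc msqrt(2)[OF p] q_def)
  then have "(r ** r) ** p = mat 1" by (simp add: msqrt_inverse)
  then have "(r ** r) ** (p ** matrix_inv p) = matrix_inv p"
    by (simp only: matrix_mul_assoc matrix_mul_lid)
  then show ?thesis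
    by (simp add: matrix_inv_mult(1)[OF spd_invertible[OF p]])
qed

text \<open>Split each \<open>matrix_inv p\<close> as \<open>r ** r\<close> and cycle one
  \<open>r\<close> around the trace.\<close>

lemma inner_p_eq:
  assumes "v \<in> sym_mats"
  shows "inner_p p v w = (r ** v ** r) \<bullet> (r ** w ** r)"
proof -
  have "(r ** v ** r) \<bullet> (r ** w ** r) = trace ((r ** v ** r ** r ** w) ** r)"
    using assms by (simp add: inner_matrix_trace matrix_transpose_mul transpose_msqrt matrix_mul_assoc
        sym_mats_def)
  also have "\<dots> = trace (r ** (r ** v ** r ** r ** w))" by (rule trace_mul_sym)
  finally show ?thesis
    by (simp add: inner_p_def matrix_inv_eq_msqrt matrix_mul_assoc)
qed

text \<open>\<open>Z_dir\<close> is the commutator of \<open>X ** r\<close> with \<open>M\<close>,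
  while multiplying \<open>M\<close> by \<open>transpose S\<close> on the right or left gives the
  left or right singular projection. Their difference is symmetric and sees only the symmetric part
  of \<open>X ** r\<close>.\<close>

lemma trace_S_mat_Z_dir:
  assumes svd: "is_svd (zeta p A) U V" and A: "invertible A" and e: "e \<in> sym_mats"
  shows "trace (transpose (S_mat k (zeta p A) U V) ** Z_dir p A e)
    = 1 / (2 * ln 2) * ((proj_mat k U - proj_mat k V) \<bullet> (r ** e ** r))"
proof -
  define M where "M = zeta p A"
  define S where "S = transpose U ** diag (\<lambda>i. if i \<le> k then inverse (\<alpha> M i) else 0) ** V"
  define H where "H = proj_mat k U - proj_mat k V"
  define X where "X = lyapunov p e"
  have X: "transpose X = X" "q ** X + X ** q = e"
    using lyapunov[OF p e] by (auto simp: X_def q_def sym_mats_def)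
  have M: "M = q ** A ** r" by (simp add: M_def zeta_def q_def r_def)
  have UV: "U ** transpose U = mat 1" "V ** transpose V = mat 1"
      and Meq: "M = transpose U ** diag (\<alpha> M) ** V"
    using svd by (auto simp: is_svd_def orthogonal_matrix_def M_def)
  \<comment> \<open>Invertibility of \<open>A\<close> passes to \<open>diag (\<alpha> M)\<close>, so
    every \<open>inverse\<close> in \<open>S\<close> is a genuine reciprocal and not the default
    \<open>inverse 0 = 0\<close>.\<close>
  have "invertible (U ** M ** transpose V)"
    using svd A msqrt_inverse UV unfolding M
    by (intro invertible_mult) (auto simp: invertible_def is_svd_def orthogonal_matrix_def)
  also have "U ** M ** transpose V = (U ** transpose U) ** diag (\<alpha> M) ** (V ** transpose V)"
    by (subst Meq) (simp only: matrix_mul_assoc)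
  finally have "det (diag (\<alpha> M) :: 'n sqmat) \<noteq> 0"
    by (simp add: UV invertible_det_nz)
  moreover have "det (diag (\<alpha> M) :: 'n sqmat) = (\<Prod>i\<in>UNIV. \<alpha> M (pos (i::'n)))"
    by (subst det_diagonal) (auto simp: diag_def)
  ultimately have nz: "\<alpha> M (pos (i::'n)) \<noteq> 0" for i by simp
  have DD: "diag (\<alpha> M) ** diag (\<lambda>i. if i \<le> k then inverse (\<alpha> M i) else 0)
      = (diag (\<lambda>i. if i \<le> k then 1 else 0) :: 'n sqmat)"
    "diag (\<lambda>i. if i \<le> k then inverse (\<alpha> M i) else 0) ** diag (\<alpha> M)
      = (diag (\<lambda>i. if i \<le> k then 1 else 0) :: 'n sqmat)"
    using nz by (auto simp: diag_mult_diag) (auto simp: diag_def vec_eq_iff)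
  have "M ** transpose S
      = transpose U ** (diag (\<alpha> M) ** (V ** transpose V) ** diag (\<lambda>i. if i \<le> k then inverse (\<alpha> M i) else 0)) ** U"
    by (subst Meq) (simp add: S_def matrix_transpose_mul transpose_diag matrix_mul_assoc)
  then have MS: "M ** transpose S = proj_mat k U"
    by (simp add: UV DD proj_mat_def)
  have "transpose S ** M = transpose S ** (transpose U ** diag (\<alpha> M) ** V)"
    by (simp only: Meq[symmetric])
  also have "\<dots>
      = transpose V ** (diag (\<lambda>i. if i \<le> k then inverse (\<alpha> M i) else 0) ** (U ** transpose U) ** diag (\<alpha> M)) ** V"
    by (simp add: S_def matrix_transpose_mul transpose_diag matrix_mul_assoc)
  finally have SM: "transpose S ** M = proj_mat k V"
    by (simp add: UV DD proj_mat_def)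
  \<comment> \<open>\<open>A ** r = r ** M\<close> rewrites the first term of \<open>Z_dir\<close>
    as \<open>(X ** r) ** M\<close>.\<close>
  have "r ** M = (r ** q) ** A ** r" by (simp add: M matrix_mul_assoc)
  then have "A ** r = r ** M" by (simp add: msqrt_inverse)
  then have Z: "Z_dir p A e = (X ** r) ** M - M ** (X ** r)"
    unfolding Z_dir_def M X_def[symmetric] q_def[symmetric] r_def[symmetric]
    by (simp add: M flip: matrix_mul_assoc)
  have "trace (transpose S ** Z_dir p A e)
      = trace ((transpose S ** (X ** r)) ** M) - trace ((transpose S ** M) ** (X ** r))"
    by (simp add: Z matrix_sub_ldistrib trace_sub matrix_mul_assoc)
  also have "trace ((transpose S ** (X ** r)) ** M) = trace ((M ** transpose S) ** (X ** r))"
    by (subst trace_mul_sym) (simp add: matrix_mul_assoc)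
  finally have tr: "trace (transpose S ** Z_dir p A e) = H \<bullet> (X ** r)"
    by (simp add: MS SM H_def inner_matrix_trace transpose_diff transpose_proj_mat
        matrix_sub_rdistrib trace_sub)
  have HT: "transpose H = H" by (simp add: H_def transpose_diff transpose_proj_mat)
  have "r ** e ** r = (r ** q) ** X ** r + r ** X ** (q ** r)"
    by (simp add: X(2)[symmetric] matrix_add_ldistrib matrix_add_rdistrib matrix_mul_assoc)
  also have "\<dots> = X ** r + transpose (X ** r)"
    by (simp add: msqrt_inverse matrix_transpose_mul X(1) transpose_msqrt)
  finally have "H \<bullet> (r ** e ** r) = 2 * (H \<bullet> (X ** r))"
    using inner_transpose[of H "X ** r"] by (simp add: inner_add_right HT)
  moreover have "trace (transpose (S_mat k M U V) ** Z_dir p A e)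
      = 1 / ln 2 * trace (transpose S ** Z_dir p A e)"
    by (simp add: S_mat_def S_def[symmetric] transpose_scalar trace_scaleR
        flip: scalar_matrix_assoc)
  ultimately show ?thesis
    by (simp add: tr H_def M_def)
qed

lemma norm_p_s2_diff_le:
  assumes B: "orthonormal_basis_p p B" and A: "invertible A" "invertible A'"
    and svd: "is_svd (zeta p A) U V" "is_svd (zeta p A') U' V'"
  shows "norm_p p (s2 p k B A U V - s2 p k B A' U' V')
    \<le> 1 / (2 * ln 2) * norm ((proj_mat k U - proj_mat k V) - (proj_mat k U' - proj_mat k V'))"
proof -
  define W where "W = (proj_mat k U - proj_mat k V) - (proj_mat k U' - proj_mat k V')"
  define T where "T e = r ** e ** r" for e
  define D where "D = s2 p k B A U V - s2 p k B A' U' V'"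
  have span: "span B = sym_mats" using B by (simp add: orthonormal_basis_p_def)
  have sym: "e \<in> sym_mats" if "e \<in> B" for e
    using that span span_base by blast
  have D: "D = (\<Sum>e\<in>B. (1 / (2 * ln 2) * (W \<bullet> T e)) *\<^sub>R e)"
    unfolding D_def s2_def sum_subtractf[symmetric]
    by (intro sum.cong) (auto simp: trace_S_mat_Z_dir svd A sym W_def T_def inner_diff_left algebra_simps)
  have linT: "linear T"
    unfolding T_def
    by (intro linearI) (simp_all add: matrix_add_ldistrib matrix_add_rdistrib
        scalar_matrix_assoc matrix_scalar_ac)
  \<comment> \<open>Membership in the span makes \<open>D\<close> symmetric, as the isometry
    \<open>inner_p_eq\<close> requires.\<close>
  have "D \<in> span B"
    unfolding D by (intro span_sum span_scale span_base)
  then have "norm_p p D = norm (T D)"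
    by (simp add: span norm_p_def inner_p_eq T_def norm_eq_sqrt_inner)
  also have "T D = (1 / (2 * ln 2)) *\<^sub>R (\<Sum>e\<in>B. (W \<bullet> T e) *\<^sub>R T e)"
    by (simp add: D linear_sum[OF linT] linear_scale[OF linT] scaleR_sum_right)
  also have "norm \<dots> \<le> 1 / (2 * ln 2) * norm W"
  proof -
    have "norm (\<Sum>e\<in>B. (W \<bullet> T e) *\<^sub>R T e) \<le> norm W"
    proof (rule bessel_norm)
      fix v w assume "v \<in> B" "w \<in> B"
      then show "T v \<bullet> T w = (if v = w then 1 else 0)"
        using B inner_p_eq[of v w] sym by (simp add: T_def orthonormal_basis_p_def)
    qed
    then show ?thesis by (simp add: divide_right_mono)
  qed
  finally show ?thesis unfolding D_def W_def .
qed

lemma norm_zeta_diff_le: "norm (zeta p A - zeta p A') \<le> norm q * norm (A - A') * norm r"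
proof -
  have "zeta p A - zeta p A' = q ** (A - A') ** r"
    by (simp add: zeta_def q_def r_def matrix_sub_ldistrib matrix_sub_rdistrib)
  moreover have "norm (q ** (A - A') ** r) \<le> norm q * norm (A - A') * norm r"
    by (meson norm_matrix_mult_le order_trans mult_right_mono norm_ge_zero)
  ultimately show ?thesis by simp
qed

end

theorem theorem4p5:
  fixes \<phi> :: "('n::{finite,linorder}) rvec \<Rightarrow> 'n rvec"
    and K :: "('n rvec) set"
    and A U V :: "'n rvec \<Rightarrow> 'n sqmat"
    and p :: "'n sqmat"
    and B :: "('n sqmat) set"
    and k :: nat
    and x y :: "'n rvec"
    and \<delta> :: real
  assumes "C1_map \<phi>"
    and "compact K" and "\<phi> ` K \<subseteq> K" and "K = closure (interior K)"
    and "A = (\<lambda>z. jacobian \<phi> (at z))"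
    and "\<forall>z\<in>K. invertible (A z)"
    and "spd p"
    and "k \<in> {1..CARD('n) - 1}"
    and "orthonormal_basis_p p B"
    and "\<forall>z\<in>K. is_svd (zeta p (A z)) (U z) (V z)"
    and "x \<in> K" and "y \<in> K"
    and "\<delta> = \<alpha> (zeta p (A y)) k - \<alpha> (zeta p (A x)) (k + 1)"
    and "\<delta> > 0"
  shows "norm_p p (s2 p k B (A x) (U x) (V x) - s2 p k B (A y) (U y) (V y))
    \<le> sqrt (2 * real CARD('n) * (real CARD('n) + 1)) / ln 2 * (1 / \<delta>)
        * fro_norm (msqrt p) * fro_norm (msqrt_inv p) * fro_norm (A x - A y)"
proof -
  let ?n = "real CARD('n)" and ?q = "norm (msqrt p)" and ?r = "norm (msqrt_inv p)"
  let ?P = "\<lambda>z. proj_mat k (U z) - proj_mat k (V z)"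
  have inv: "invertible (A x)" "invertible (A y)"
    and svd: "is_svd (zeta p (A x)) (U x) (V x)" "is_svd (zeta p (A y)) (U y) (V y)"
    using assms by auto
  have k: "1 \<le> k" "k < CARD('n)" using assms(8) by auto
  have "norm_p p (s2 p k B (A x) (U x) (V x) - s2 p k B (A y) (U y) (V y))
      \<le> 1 / (2 * ln 2) * norm (?P x - ?P y)"
    by (rule norm_p_s2_diff_le) (use assms(7,9) inv svd in auto)
  also have "\<dots> \<le> 1 / (2 * ln 2) * (sqrt 8 / \<delta> * norm (zeta p (A x) - zeta p (A y)))"
    by (intro mult_left_mono norm_proj_mat_gap[OF svd k assms(13,14)]) auto
  also have "\<dots> \<le> 1 / (2 * ln 2) * (sqrt 8 / \<delta> * (?q * norm (A x - A y) * ?r))"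
    using assms(14) by (intro mult_left_mono norm_zeta_diff_le assms(7)) auto
  \<comment> \<open>The constant obtained so far is \<open>sqrt 8 / 2\<close>, that is
    \<open>sqrt 2\<close>, independent of the dimension.\<close>
  also have "\<dots> = sqrt 8 / 2 * (?q * ?r * norm (A x - A y) / (ln 2 * \<delta>))"
    by (simp add: field_simps)
  also have "\<dots> \<le> sqrt (2 * ?n * (?n + 1)) * (?q * ?r * norm (A x - A y) / (ln 2 * \<delta>))"
  proof (rule mult_right_mono)
    have "sqrt 8 \<le> sqrt (2 * ?n * (?n + 1))"
    proof -
      \<comment> \<open>The range of \<open>k\<close> forces n to be at least 2, so the stated
        constant is at least \<open>sqrt 12\<close>.\<close>
      have "2 * (2 + 1) \<le> ?n * (?n + 1)"
        using k by (intro mult_mono) auto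
      then show ?thesis by simp
    qed
    then show "sqrt 8 / 2 \<le> sqrt (2 * ?n * (?n + 1))"
      using real_sqrt_ge_zero[of 8] by linarith
  qed (use assms(14) in auto)
  also have "\<dots> = sqrt (2 * ?n * (?n + 1)) / ln 2 * (1 / \<delta>)
        * fro_norm (msqrt p) * fro_norm (msqrt_inv p) * fro_norm (A x - A y)"
    by (simp add: fro_norm_eq_norm)
  finally show ?thesis .
qed

end
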